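(* Let $F$ satisfy the weak sequential closedness condition $$(q_n\rightharpoonup q \ \wedge \ F(q_n)\to g)\ \Rightarrow\ (q\in\mathcal D(F)\ \wedge\ F(q)=g)\qquad\text{for all } \{q_n\}_{n\in\mathbb N}\subseteq Q$$ and the tangential cone condition $$\|F(q)-F(\bar q)-F'(q)(q-\bar q)\|_G\le c_{tc}\|F(q)-F(\bar q)\|_G\qquad \forall q,\bar q\in \mathcal B_\rho(q_0)\subseteq\mathcal D(F)\subseteq Q$$ for some $\rho>0$, with $0<c_{tc}<\frac14$ sufficiently small. Let, further, $\tau>0$ be chosen sufficiently large and $0<\tilde{\underline\theta}<\tilde{\overline\theta}$ sufficiently small, such that $$2\Big(c_{tc}^2+\frac{(1+c_{tc})^2}{\tau^2}\Big)<\tilde{\underline\theta}\quad\text{and}\quad \frac{2\tilde{\overline\theta}+4c_{tc}^2}{1-4c_{tc}^2}<1 .$$ Finally, let the discretization errors with respect to the quantities of interest satisfy $|I_{i,h}^k-I_i^k|\le\eta_i^k$, $i\in\{1,2,3,4\}$, where $\eta_1^k,\eta_2^k,\eta_3^k,\eta_4^k$ are selected such that $$\eta_1^k+2c_{tc}^2\eta_3^k\le\Big(\tilde{\underline\theta}-2\Big(c_{tc}^2+\frac{(1+c_{tc})^2}{\tau^2}\Big)\Big)I_{3,h}^k,$$ $$\eta_3^k\le c_1 I_{3,h}^k\quad\text{and}\quad \eta_2^k\to0,\ \eta_3^k\to0,\ \eta_4^k\to0\ \text{ as }k\to\infty,$$ $$I_{3,h}^k\le(1+c_3)I_{4,h}^{k-1}+r^k\quad\text{and}\quad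 (1+c_3)\frac{2\tilde{\overline\theta}+4c_{tc}^2}{1-4c_{tc}^2}\le c_2<1$$ for some constants $c_1,c_2,c_3>0$ and a sequence $r^k\to0$ as $k\to\infty$ (the last condition on $c_2,c_3$ being possible due to the second condition on $\tilde{\overline\theta}, c_{tc}$ above). Then, with $\beta_k$ and $h=h_k$ fulfilling $$\tilde{\underline\theta}\,I_{3,h}^k\le I_{2,h}^k\le\tilde{\overline\theta}\,I_{3,h}^k$$ and $k_*$ selected according to $k_*=\min\{k\in\mathbb N: I_{3,h}^k\le\tau^2\delta^2\}$, there holds: (i) For any solution $q^\dagger\in\mathcal B_\rho(q_0)$ of $F(q)=g$, $$\|q_h^k-q_0\|_Q^2\le\|q^\dagger-q_0\|_Q^2\qquad\forall k<k_* .$$ (ii) $k_*$ is finite. (iii) $q_{\mathrm{old}}^{k_*}=q_{h_{k_*-1}}^{k_*-1}$ converges (weakly) subsequentially to a solution of $F(q)=g$ as $\delta\to0$, in the sense that it has a weakly convergent subsequence and each weakly convergent subsequence converges strongly to a solution of $F(q)=g$. If the solution $q^\dagger$ of $F(q)=g$ is unique, then $q_{\mathrm{old}}^{k_*}$ converges strongly to $q^\dagger$ as $\delta\to0$.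
   Context: Setting. $Q,V,W,G$ are Hilbert spaces. The nonlinear operator is $F=C\circ S$, with domain $\mathcal D(F)\subseteq Q$ and values in $G$, where $C:V\to G$ is a measurement operator and $S:q\mapsto u\in V$ is the parameter-to-solution map of a (possibly nonlinear) PDE given in weak form with test space $W$; this PDE and its linearization are assumed uniquely and stably solvable. $F'(q)$ is the derivative of $F$ at $q$. $g\in G$ is the exact data and $g^\delta\in G$ the noisy data, with $\|g-g^\delta\|_G\le\delta$. A solution $q^\dagger$ of $F(q)=g$ is assumed to exist. $\mathcal B_\rho(q_0)$ is the ball of radius $\rho$ around the a priori guess $q_0\in Q$. Discretization. $Q_h,V_h,W_h$ are finite element spaces for $Q,V,W$; $S_h$ is the discrete solution operator of the PDE (solution in $V_h$, test functions in $W_h$), and $F_h=C\circ S_h$ with derivative $F_h'$. The norms in $Q$ and $G$ and the operator $C$ are evaluated exactly. The discretization may change from step to step; $h=h_k$ denotes the one in step $k$. Iteration (discretized iteratively regularized Gauss-Newton method). In step $k$, given $q_{\mathrm{old}}^k\in Q_{h_k}$ and a regularization parameter $\beta_k>0$, the discrete iterate $q_h^k=q^k_{h_k}$ is a minimizer over $q\in Q_{h_k}$ of $$\|F_{h_k}'(q_{\mathrm{old}}^k)(q-q_{\mathrm{old}}^k)+F_{h_k}(q_{\mathrm{old}}^k)-g^\delta\|_G^2+\tfrac1{\beta_k}\|q-q_0\|_Q^2,$$ the auxiliary continuous iterate $q^k$ is a minimizer over $q\in Q$ of $$\|F'(q_{\mathrm{old}}^k)(q-q_{\mathrm{old}}^k)+F(q_{\mathrm{old}}^k)-g^\delta\|_G^2+\tfrac1{\beta_k}\|q-q_0\|_Q^2,$$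 and one sets $q_{\mathrm{old}}^{k+1}:=q_{h_k}^k$. The dependence of all iterates on $\delta$ and $g^\delta$ is suppressed in the notation. Quantities of interest. $I_1^k=\|F'(q_{\mathrm{old}}^k)(q^k-q_{\mathrm{old}}^k)+F(q_{\mathrm{old}}^k)-g^\delta\|_G^2+\frac1{\beta_k}\|q^k-q_0\|_Q^2$, $I_2^k=\|F'(q_{\mathrm{old}}^k)(q^k-q_{\mathrm{old}}^k)+F(q_{\mathrm{old}}^k)-g^\delta\|_G^2$, $I_3^k=\|F(q_{\mathrm{old}}^k)-g^\delta\|_G^2$, $I_4^k=\|F(q^k)-g^\delta\|_G^2$; $I_{1,h}^k=\|F_{h_k}'(q_{\mathrm{old}}^k)(q_{h_k}^k-q_{\mathrm{old}}^k)+F_{h_k}(q_{\mathrm{old}}^k)-g^\delta\|_G^2+\frac1{\beta_k}\|q_{h_k}^k-q_0\|_Q^2$, $I_{2,h}^k=\|F_{h_k}'(q_{\mathrm{old}}^k)(q_{h_k}^k-q_{\mathrm{old}}^k)+F_{h_k}(q_{\mathrm{old}}^k)-g^\delta\|_G^2$, $I_{3,h}^k=\|F_{h_k}(q_{\mathrm{old}}^k)-g^\delta\|_G^2$, $I_{4,h}^k=\|F_{h_k}(q_{h_k}^k)-g^\delta\|_G^2$.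
   Formalization: The formal theorem adds that the starting value q_old^0 lies in the (closed) ball B_rho(q_0) and is the same for all noise levels delta, and that at least one solution of F(q)=g lies in that ball; with an arbitrary starting value the claim fails. *)

theory Defs
  imports "HOL-Analysis.Analysis"
begin

text \<open>Real Hilbert spaces are types of sort \<open>{real_inner, complete_space}\<close>.\<close>

definition weakly_converges :: "(nat \<Rightarrow> 'a::real_inner) \<Rightarrow> 'a \<Rightarrow> bool"
  where "weakly_converges x l \<longleftrightarrow> (\<forall>y. (\<lambda>n. inner (x n) y) \<longlonglongrightarrow> inner l y)"

text \<open>
  A PDE in weak form is \<open>A q u = f\<close> in the dual of the test space, where \<open>A q u\<close> and \<open>f\<close> are
  bounded linear functionals of the test function. With \<open>X = UNIV\<close> and \<open>Y = UNIV\<close> the following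
  says that \<open>S\<close> is the parameter-to-solution map; with subspaces \<open>X\<close> (ansatz) and \<open>Y\<close> (test) it
  says that \<open>S\<close> is the discrete solution operator. Unique solvability for the parameters in \<open>D\<close>
  is included.
\<close>

definition solution_operator ::
    "'q set \<Rightarrow> ('q \<Rightarrow> 'v \<Rightarrow> ('w::real_normed_vector \<Rightarrow>\<^sub>L real)) \<Rightarrow> ('w \<Rightarrow>\<^sub>L real) \<Rightarrow>
      'v set \<Rightarrow> 'w set \<Rightarrow> ('q \<Rightarrow> 'v) \<Rightarrow> bool"
  where "solution_operator D A f X Y S \<longleftrightarrow>
    (\<forall>q\<in>D. \<forall>u. (u \<in> X \<and> (\<forall>w\<in>Y. blinfun_apply (A q u) w = blinfun_apply f w)) \<longleftrightarrow> u = S q)"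

text \<open>
  At every state \<open>S q\<close>, the linearization \<open>L v = \<phi>\<close> of the PDE has exactly one solution \<open>v\<close>
  for every right-hand side \<open>\<phi>\<close> in the dual of the test space, and \<open>v\<close> depends boundedly
  on \<open>\<phi>\<close>.
\<close>

definition linearization_stably_solvable ::
    "'q set \<Rightarrow> ('q \<Rightarrow> 'v::real_normed_vector \<Rightarrow> ('w::real_normed_vector \<Rightarrow>\<^sub>L real)) \<Rightarrow>
      ('q \<Rightarrow> 'v) \<Rightarrow> bool"
  where "linearization_stably_solvable D A S \<longleftrightarrow>
    (\<forall>q\<in>D. \<exists>L. ((\<lambda>u. A q u) has_derivative L) (at (S q)) \<and> bij L \<and> bounded_linear (inv L))"

definition fin_dim_subspace :: "'a::real_vector set \<Rightarrow> bool"
  where "fin_dim_subspace X \<longleftrightarrow> (\<exists>B. finite B \<and> X = span B)"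

definition misfit :: "('q \<Rightarrow> 'g::real_normed_vector) \<Rightarrow> 'g \<Rightarrow> 'q \<Rightarrow> real"
  where "misfit F y q = (norm (F q - y))\<^sup>2"

definition lin_misfit ::
    "('q::real_normed_vector \<Rightarrow> 'g::real_normed_vector) \<Rightarrow> ('q \<Rightarrow> ('q \<Rightarrow>\<^sub>L 'g)) \<Rightarrow> 'g \<Rightarrow>
      'q \<Rightarrow> 'q \<Rightarrow> real"
  where "lin_misfit F F' y p q = (norm (blinfun_apply (F' p) (q - p) + F p - y))\<^sup>2"

definition tikhonov ::
    "('q::real_normed_vector \<Rightarrow> 'g::real_normed_vector) \<Rightarrow> ('q \<Rightarrow> ('q \<Rightarrow>\<^sub>L 'g)) \<Rightarrow> 'g \<Rightarrow>
      real \<Rightarrow> 'q \<Rightarrow> 'q \<Rightarrow> 'q \<Rightarrow> real"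
  where "tikhonov F F' y \<beta> q0 p q = lin_misfit F F' y p q + 1 / \<beta> * (norm (q - q0))\<^sup>2"

text \<open>The first index with \<open>I k \<le> b\<close>; it is \<open>\<infinity>\<close> if there is none.\<close>

definition stopping_index :: "(nat \<Rightarrow> real) \<Rightarrow> real \<Rightarrow> enat"
  where "stopping_index I b = Inf (enat ` {k. I k \<le> b})"

end

theory Submission
  imports Defs "HOL-Library.Diagonal_Subsequence"
begin

text \<open>
  Comparing the Tikhonov functional at the minimizer and at a solution \<open>qd\<close>, the tangential cone
  condition bounds the linearized misfit at \<open>qd\<close> by a multiple of \<open>I3h\<close> that is smaller than
  \<open>\<theta>l * I3h\<close>; as the choice of \<open>\<beta>\<close> keeps \<open>I2h\<close> above \<open>\<theta>l * I3h\<close>, only \<open>norm (qh - q0) \<le> norm (qd - q0)\<close>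
  is possible. If the iteration never stopped, then \<open>I3h > \<tau>\<^sup>2 * \<delta>\<^sup>2\<close> throughout, so the same argument
  eventually puts the continuous minimizers into the ball, where the tangential cone condition makes
  \<open>I3h\<close> contract up to a null sequence, which contradicts its positive lower bound. Convergence
  follows from weak compactness of balls, and it is strong since the norms of the iterates are
  bounded by that of the limit.
\<close>

section \<open>Hilbert space tools: Riesz representation, weak compactness, weak limits\<close>

text \<open>The representer minimizes the quadratic functional \<open>J\<close> over
  \<open>Y\<close>; its vanishing first variation is the claimed identity. Stating this for a closed
  subspace covers two uses below: \<open>Y = UNIV\<close> represents a functional, and
  \<open>\<phi> = inner y\<close> yields the orthogonal projection of \<open>y\<close> onto
  \<open>Y\<close>.\<close>

lemma riesz_on_closed_subspace:
  fixes Y :: "'a::{real_inner,complete_space} set" and \<phi> :: "'a \<Rightarrow> real"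
  assumes Y: "subspace Y" "closed Y" and \<phi>: "bounded_linear \<phi>"
  obtains z where "z \<in> Y" "\<And>y. y \<in> Y \<Longrightarrow> inner z y = \<phi> y"
proof -
  interpret \<phi>: bounded_linear \<phi> by (fact \<phi>)
  define J where "J y = inner y y - 2 * \<phi> y" for y
  obtain K where K: "\<And>y. norm (\<phi> y) \<le> norm y * K"
    using \<phi>.bounded by blast
  have lower: "- K\<^sup>2 \<le> J y" for y
  proof -
    have "0 \<le> (norm y - K)\<^sup>2" by simp
    then have "- K\<^sup>2 \<le> inner y y - 2 * (norm y * K)"
      by (simp add: power2_diff power2_norm_eq_inner)
    also have "\<dots> \<le> J y" using K[of y] by (simp add: J_def)
    finally show ?thesis .
  qed
  have bdd: "bdd_below (J ` Y)" by (rule bdd_belowI2[of _ "- K\<^sup>2"]) (rule lower)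
  have ne: "J ` Y \<noteq> {}" using subspace_0[OF Y(1)] by blast
  define m where "m = Inf (J ` Y)"
  have m_le: "m \<le> J y" if "y \<in> Y" for y
    unfolding m_def using bdd that by (simp add: cInf_lower)
  have "\<exists>y\<in>Y. J y < m + inverse (real (Suc n))" for n
    using cInf_lessD[OF ne, of "m + inverse (real (Suc n))"] unfolding m_def[symmetric] by auto
  then obtain y where yY: "\<And>n. y n \<in> Y" and yJ: "\<And>n. J (y n) < m + inverse (real (Suc n))"
    by metis
  \<comment> \<open>The squared distance equals \<open>2 * J a + 2 * J b\<close> minus four times
    \<open>J\<close> at the midpoint, which lies in \<open>Y\<close>. Hence minimizing sequences are
    Cauchy.\<close>
  have parallelogram: "(norm (a - b))\<^sup>2 \<le> 2 * (J a - m) + 2 * (J b - m)" if "a \<in> Y" "b \<in> Y" for a b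
  proof -
    have "(1/2) *\<^sub>R (a + b) \<in> Y" using Y(1) that by (intro subspace_scale subspace_add)
    then have "m \<le> J ((1/2) *\<^sub>R (a + b))" by (rule m_le)
    also have "\<dots> = inner (a + b) (a + b) / 4 - (\<phi> a + \<phi> b)"
      by (simp add: J_def \<phi>.scaleR \<phi>.add inner_simps field_simps)
    finally show ?thesis
      by (simp add: J_def power2_norm_eq_inner inner_simps inner_commute field_simps)
  qed
  have "Cauchy y"
  proof (rule CauchyI)
    fix e :: real assume e: "0 < e"
    then obtain N where N: "inverse (real (Suc N)) < e\<^sup>2 / 4"
      using reals_Archimedean[of "e\<^sup>2 / 4"] by auto
    have small: "J (y n) - m < e\<^sup>2 / 4" if "n \<ge> N" for n
    proof -
      have "inverse (real (Suc n)) \<le> inverse (real (Suc N))" using that by simp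
      then show ?thesis using yJ[of n] N by linarith
    qed
    have "norm (y i - y j) < e" if "i \<ge> N" "j \<ge> N" for i j
    proof -
      have "(norm (y i - y j))\<^sup>2 < e\<^sup>2"
        using parallelogram[OF yY yY, of i j] small[OF that(1)] small[OF that(2)] by argo
      then show ?thesis using e by (simp add: power2_less_imp_less)
    qed
    then show "\<exists>M. \<forall>i\<ge>M. \<forall>j\<ge>M. norm (y i - y j) < e" by blast
  qed
  then obtain z where z: "y \<longlonglongrightarrow> z"
    using Cauchy_convergent_iff convergent_def by blast
  have zY: "z \<in> Y" using closed_sequentially[OF Y(2) _ z] yY by blast
  have "(\<lambda>n. J (y n)) \<longlonglongrightarrow> J z"
    unfolding J_def by (intro tendsto_intros \<phi>.tendsto z)
  moreover have "(\<lambda>n. m + inverse (real (Suc n))) \<longlonglongrightarrow> m + 0"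
    by (intro tendsto_intros LIMSEQ_inverse_real_of_nat)
  ultimately have "J z \<le> m + 0"
    by (rule LIMSEQ_le) (use yJ less_imp_le in blast)
  then have Jz: "J z \<le> J (z + t *\<^sub>R v)" if "v \<in> Y" for t v
    using m_le[of "z + t *\<^sub>R v"] Y(1) zY that by (simp add: subspace_add subspace_scale)
  have "inner z v = \<phi> v" if v: "v \<in> Y" for v
  proof (cases "v = 0")
    case False
    define d where "d = inner z v - \<phi> v"
    \<comment> \<open>This \<open>t\<close> minimizes the quadratic polynomial
      \<open>J (z + t *\<^sub>R v) - J z\<close> in \<open>t\<close>.\<close>
    define t where "t = - d / inner v v"
    have vv: "inner v v > 0" using False by simp
    have "0 \<le> 2 * t * d + t\<^sup>2 * inner v v"
      using Jz[OF v, of t]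
      by (simp add: J_def d_def inner_simps \<phi>.add \<phi>.scaleR inner_commute algebra_simps power2_eq_square)
    also have "\<dots> = - (d\<^sup>2 / inner v v)"
      using vv by (simp add: t_def field_simps power2_eq_square)
    finally have "d\<^sup>2 / inner v v \<le> 0" by simp
    then have "d = 0" using vv by (simp add: divide_le_0_iff)
    then show ?thesis by (simp add: d_def)
  qed (simp add: \<phi>.zero)
  with zY show thesis by (rule that)
qed

text \<open>A diagonal argument makes the inner products with each member of the sequence itself
  converge. The test vectors with convergent products form a closed subspace \<open>Y\<close>, and
  projecting an arbitrary test vector onto \<open>Y\<close> does not change its products with the
  sequence. The limit functional is bounded, so it has a representer, the weak limit.\<close>

lemma bounded_seq_weakly_convergent_subseq:
  fixes x :: "nat \<Rightarrow> 'a::{real_inner,complete_space}"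
  assumes B: "\<And>n. norm (x n) \<le> B"
  obtains s l where "strict_mono (s :: nat \<Rightarrow> nat)" "weakly_converges (\<lambda>n. x (s n)) l"
proof -
  have bound: "norm (inner (x k) y) \<le> B * norm y" for k y
    using Cauchy_Schwarz_ineq2[of "x k" y] mult_right_mono[OF B[of k] norm_ge_zero[of y]] by simp
  interpret subseqs "\<lambda>n s. convergent (\<lambda>k. inner (x (s k)) (x n))"
  proof
    fix n and s :: "nat \<Rightarrow> nat"
    have "bounded (range (\<lambda>k. inner (x (s k)) (x n)))"
      using bound by (intro boundedI) auto
    then obtain l r where "strict_mono (r :: nat \<Rightarrow> nat)"
      "((\<lambda>k. inner (x (s k)) (x n)) \<circ> r) \<longlonglongrightarrow> l"
      using bounded_imp_convergent_subsequence by blast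
    then show "\<exists>r. strict_mono r \<and> convergent (\<lambda>k. inner (x ((s \<circ> r) k)) (x n))"
      by (auto simp: convergent_def comp_def)
  qed
  define s where "s = diagseq"
  have s: "strict_mono s" unfolding s_def by (rule subseq_diagseq)
  define Y where "Y = {y. convergent (\<lambda>k. inner (x (s k)) y)}"
  have xY: "x n \<in> Y" for n
  proof -
    \<comment> \<open>\<open>diagseq\<close> is a subsequence of the one chosen for \<open>n\<close>
      only after its first \<open>Suc n\<close> terms.\<close>
    have "convergent (\<lambda>k. inner (x ((diagseq \<circ> ((+) (Suc n))) k)) (x n))"
    proof (rule diagseq_holds)
      fix r s :: "nat \<Rightarrow> nat" and n
      assume "strict_mono r" "convergent (\<lambda>k. inner (x (s k)) (x n))"
      then show "convergent (\<lambda>k. inner (x ((s \<circ> r) k)) (x n))"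
        using convergent_subseq_convergent[of "\<lambda>k. inner (x (s k)) (x n)" r] by (simp add: comp_def)
    qed
    then have "convergent (\<lambda>k. inner (x (s (k + Suc n))) (x n))"
      by (simp add: s_def comp_def add.commute)
    then show ?thesis
      unfolding Y_def using convergent_ignore_initial_segment by blast
  qed
  have sub: "subspace Y"
    unfolding subspace_def Y_def
    by (auto simp: inner_simps intro: convergent_add convergent_mult convergent_const)
  have cl: "closed Y"
    unfolding closed_sequential_limits
  proof (intro allI impI, elim conjE)
    show "l \<in> Y" if yY: "\<forall>j. y j \<in> Y" and lim: "y \<longlonglongrightarrow> l" for y l
    proof -
      \<comment> \<open>Three-epsilon argument: exchanging \<open>l\<close> for a nearby
        \<open>y j\<close> costs less than \<open>e / 3\<close> uniformly in \<open>k\<close>. Using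
        \<open>B + 1\<close> keeps the divisor positive when \<open>B = 0\<close>.\<close>
      have "Cauchy (\<lambda>k. inner (x (s k)) l)"
      proof (rule CauchyI)
        fix e :: real assume e: "0 < e"
        have B0: "0 \<le> B" using B[of 0] norm_ge_zero order_trans by blast
        obtain j where j: "norm (y j - l) < e / (3 * (B + 1))"
          using LIMSEQ_D[OF lim, of "e / (3 * (B + 1))"] e B0 by auto
        have near: "norm (inner (x k) (y j) - inner (x k) l) < e / 3" for k
        proof -
          have "norm (inner (x k) (y j) - inner (x k) l) \<le> B * norm (y j - l)"
            using bound[of k "y j - l"] by (simp add: inner_diff_right)
          also have "\<dots> \<le> (B + 1) * norm (y j - l)" by (simp add: mult_right_mono)
          also have "\<dots> < e / 3" using j B0 by (simp add: field_simps)
          finally show ?thesis .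
        qed
        have "Cauchy (\<lambda>k. inner (x (s k)) (y j))"
          using yY by (simp add: Y_def Cauchy_convergent_iff)
        then obtain M where M: "\<And>a b. a \<ge> M \<Longrightarrow> b \<ge> M \<Longrightarrow>
            norm (inner (x (s a)) (y j) - inner (x (s b)) (y j)) < e / 3"
          using CauchyD[of _ "e / 3"] e by fastforce
        have "norm (inner (x (s a)) l - inner (x (s b)) l) < e" if "a \<ge> M" "b \<ge> M" for a b
          using M[OF that] near[of "s a"] near[of "s b"] unfolding real_norm_def by linarith
        then show "\<exists>M. \<forall>a\<ge>M. \<forall>b\<ge>M. norm (inner (x (s a)) l - inner (x (s b)) l) < e" by blast
      qed
      then show ?thesis by (simp add: Y_def Cauchy_convergent_iff)
    qed
  qed
  have conv: "convergent (\<lambda>k. inner (x (s k)) y)" for y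
  proof -
    obtain p where p: "p \<in> Y" "\<And>v. v \<in> Y \<Longrightarrow> inner p v = inner y v"
      using riesz_on_closed_subspace[OF sub cl bounded_linear_inner_right[of y]] by blast
    then have "inner (x (s k)) p = inner (x (s k)) y" for k
      using p(2)[OF xY] by (metis inner_commute)
    then show ?thesis using p(1) by (simp add: Y_def)
  qed
  define \<phi> where "\<phi> y = lim (\<lambda>k. inner (x (s k)) y)" for y
  have \<phi>: "(\<lambda>k. inner (x (s k)) y) \<longlonglongrightarrow> \<phi> y" for y
    using conv unfolding \<phi>_def convergent_LIMSEQ_iff .
  have "bounded_linear \<phi>"
  proof (rule bounded_linear_intro)
    fix a b :: 'a and c :: real
    show "\<phi> (a + b) = \<phi> a + \<phi> b"
      by (rule LIMSEQ_unique[OF \<phi>]) (use tendsto_add[OF \<phi> \<phi>, of a b] in \<open>simp add: inner_simps\<close>)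
    show "\<phi> (c *\<^sub>R a) = c *\<^sub>R \<phi> a"
      by (rule LIMSEQ_unique[OF \<phi>]) (use tendsto_mult_left[OF \<phi>, of c a] in \<open>simp add: inner_simps\<close>)
    show "norm (\<phi> a) \<le> norm a * B"
      by (rule LIMSEQ_le_const2[OF tendsto_norm[OF \<phi>]]) (use bound in \<open>auto simp: mult.commute\<close>)
  qed
  then obtain l where "\<And>y. inner l y = \<phi> y"
    using riesz_on_closed_subspace[of UNIV \<phi>] by (auto simp: subspace_UNIV)
  then have "weakly_converges (\<lambda>n. x (s n)) l"
    using \<phi> by (simp add: weakly_converges_def)
  with s show thesis by (rule that)
qed

lemma weakly_converges_norm_le:
  assumes w: "weakly_converges x l" and R: "\<And>n. norm (x n - a) \<le> R"
  shows "norm (l - a) \<le> R"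
proof (cases "l = a")
  case True
  then show ?thesis using order_trans[OF norm_ge_zero R[of 0]] by simp
next
  case False
  have lim: "(\<lambda>n. inner (x n) (l - a) - inner a (l - a)) \<longlonglongrightarrow> inner l (l - a) - inner a (l - a)"
    using w by (intro tendsto_diff[OF _ tendsto_const]) (simp add: weakly_converges_def)
  have "inner (x n) (l - a) - inner a (l - a) \<le> R * norm (l - a)" for n
    using norm_cauchy_schwarz[of "x n - a" "l - a"] mult_right_mono[OF R[of n] norm_ge_zero[of "l - a"]]
    by (simp add: inner_diff_left)
  then have "inner l (l - a) - inner a (l - a) \<le> R * norm (l - a)"
    by (intro LIMSEQ_le_const2[OF lim] exI allI impI)
  then have "norm (l - a) * norm (l - a) \<le> R * norm (l - a)"
    by (simp only: inner_diff_left[symmetric] power2_norm_eq_inner[symmetric] power2_eq_square)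
  then show ?thesis using False by simp
qed

text \<open>Expand the squared norm of \<open>(x n - a) - (l - a)\<close>: the bound controls its
  quadratic part, and weak convergence tested with \<open>l - a\<close> sends the resulting majorant
  to 0.\<close>

lemma weakly_converges_imp_tendsto:
  assumes w: "weakly_converges x l" and R: "\<And>n. norm (x n - a) \<le> norm (l - a) \<or> x n = l"
  shows "x \<longlonglongrightarrow> l"
proof -
  have "(\<lambda>n. 2 * inner (l - a) (l - a) - 2 * (inner (x n) (l - a) - inner a (l - a))) \<longlonglongrightarrow>
      2 * inner (l - a) (l - a) - 2 * (inner l (l - a) - inner a (l - a))"
    using w by (intro tendsto_diff tendsto_mult tendsto_const) (simp add: weakly_converges_def)
  then have lim: "(\<lambda>n. 2 * inner (l - a) (l - a) - 2 * inner (x n - a) (l - a)) \<longlonglongrightarrow> 0"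
    by (simp add: inner_diff_left)
  have "(norm (x n - l))\<^sup>2 \<le> 2 * inner (l - a) (l - a) - 2 * inner (x n - a) (l - a)" for n
  proof -
    have "(norm (x n - a))\<^sup>2 \<le> (norm (l - a))\<^sup>2" using R[of n] by auto
    moreover have "(norm (x n - l))\<^sup>2 =
        (norm (x n - a))\<^sup>2 - 2 * inner (x n - a) (l - a) + (norm (l - a))\<^sup>2"
      unfolding power2_norm_eq_inner by (simp add: inner_simps inner_commute)
    ultimately show ?thesis by (simp add: power2_norm_eq_inner)
  qed
  then have "(\<lambda>n. (norm (x n - l))\<^sup>2) \<longlonglongrightarrow> 0"
    by (intro Lim_null_comparison[OF always_eventually lim]) simp
  then have "(\<lambda>n. sqrt ((norm (x n - l))\<^sup>2)) \<longlonglongrightarrow> sqrt 0"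
    by (rule tendsto_real_sqrt)
  then have "(\<lambda>n. norm (x n - l)) \<longlonglongrightarrow> 0" by simp
  then have "(\<lambda>n. x n - l) \<longlonglongrightarrow> 0" by (rule tendsto_norm_zero_cancel)
  then show ?thesis by (rule LIM_zero_cancel)
qed

section \<open>Stopping index and a scalar recursion\<close>

text \<open>A finite value excludes the empty set, whose infimum in \<open>enat\<close> is infinite;
  a nonempty set attains its infimum.\<close>

lemma stopping_indexE:
  assumes "stopping_index I b = enat k"
  shows "I k \<le> b"
proof -
  have "enat ` {k. I k \<le> b} \<noteq> {}"
    using assms by (auto simp: stopping_index_def Inf_enat_def split: if_splits)
  then have "Inf (enat ` {k. I k \<le> b}) \<in> enat ` {k. I k \<le> b}"
    by (auto intro: wellorder_InfI)
  then show ?thesis using assms by (auto simp: stopping_index_def)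
qed

lemma less_stopping_index: "enat k < stopping_index I b \<Longrightarrow> b < I k"
  unfolding stopping_index_def by (metis (mono_tags) Inf_lower image_eqI leD linorder_not_less mem_Collect_eq)

text \<open>While \<open>x\<close> stays above \<open>m\<close>, the factor \<open>c\<close> removes
  at least \<open>(1 - c) * m\<close> per step. Once \<open>e\<close> is below half of that,
  \<open>x\<close> drops by the fixed amount \<open>d\<close> in each step and must become
  negative.\<close>

lemma no_positive_contraction:
  fixes x e :: "nat \<Rightarrow> real"
  assumes c: "c < 1" and e: "e \<longlonglongrightarrow> 0" and m: "m > 0" and x: "\<And>k. m \<le> x k"
    and step: "eventually (\<lambda>k. x (Suc k) \<le> c * x k + e k) sequentially"
  shows False
proof -
  define d where "d = (1 - c) * m / 2"
  have d: "d > 0" using c m by (simp add: d_def)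
  from eventually_conj[OF step order_tendstoD(2)[OF e d]] obtain N where N: "\<And>k. k \<ge> N \<Longrightarrow> x (Suc k) \<le> c * x k + e k \<and> e k < d"
    by (auto simp: eventually_sequentially)
  have dec: "x (Suc k) \<le> x k - d" if "k \<ge> N" for k
  proof -
    have "(1 - c) * m \<le> (1 - c) * x k" using c x by (intro mult_left_mono) auto
    then show ?thesis using N[OF that] unfolding d_def left_diff_distrib by argo
  qed
  have "x (N + j) \<le> x N - real j * d" for j
  proof (induction j)
    case (Suc j)
    then show ?case using dec[of "N + j"] by (simp add: algebra_simps)
  qed simp
  moreover obtain j where "x N < real j * d" using d reals_Archimedean3 by blast
  ultimately show False using x[of "N + j"] m by (smt (verit))
qed

section \<open>Consequences of the tangential cone condition\<close>

lemma power2_add_le: "((a::real) + b)\<^sup>2 \<le> 2 * a\<^sup>2 + 2 * b\<^sup>2"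
  using sum_squares_bound[of a b] by (simp add: power2_sum)

text \<open>The linearized residual at \<open>q\<close> is the cone remainder plus the data error.
  Replacing \<open>F q\<close> by \<open>y\<close> inside the cone bound costs another
  \<open>c * \<delta>\<close>, whence \<open>1 + c\<close>; squaring the sum gives the factors
  2.\<close>

lemma lin_misfit_at_solution_le:
  assumes tcc: "norm (F p - F q - blinfun_apply (F' p) (p - q)) \<le> c * norm (F p - F q)"
    and noise: "norm (F q - y) \<le> \<delta>" and c: "0 \<le> c"
  shows "lin_misfit F F' y p q \<le> 2 * c\<^sup>2 * misfit F y p + 2 * (1 + c)\<^sup>2 * \<delta>\<^sup>2"
proof -
  have "blinfun_apply (F' p) (q - p) + F p - y =
      (F p - F q - blinfun_apply (F' p) (p - q)) + (F q - y)"
    by (simp add: blinfun.diff_right)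
  then have "norm (blinfun_apply (F' p) (q - p) + F p - y) \<le> c * norm (F p - F q) + \<delta>"
    using norm_triangle_ineq[of "F p - F q - blinfun_apply (F' p) (p - q)" "F q - y"] tcc noise by simp
  also have "norm (F p - F q) \<le> norm (F p - y) + \<delta>"
    using norm_triangle_ineq4[of "F p - y" "F q - y"] noise by simp
  then have "c * norm (F p - F q) + \<delta> \<le> c * norm (F p - y) + (1 + c) * \<delta>"
    using mult_left_mono[OF _ c] by (fastforce simp: algebra_simps)
  finally have "lin_misfit F F' y p q \<le> (c * norm (F p - y) + (1 + c) * \<delta>)\<^sup>2"
    unfolding lin_misfit_def by (intro power_mono) auto
  also have "\<dots> \<le> 2 * (c * norm (F p - y))\<^sup>2 + 2 * ((1 + c) * \<delta>)\<^sup>2" by (rule power2_add_le)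
  finally show ?thesis by (simp add: misfit_def power_mult_distrib)
qed

text \<open>The residual at \<open>q\<close> is the linearized residual minus the cone remainder.
  The bound on the remainder contains the residual at \<open>q\<close> itself, which is absorbed on
  the left; this produces the divisor \<open>1 - 4 * c\<^sup>2\<close>.\<close>

lemma misfit_le_lin_misfit:
  assumes tcc: "norm (F p - F q - blinfun_apply (F' p) (p - q)) \<le> c * norm (F p - F q)"
    and c: "0 \<le> c" "4 * c\<^sup>2 < 1"
  shows "misfit F y q \<le> (2 * lin_misfit F F' y p q + 4 * c\<^sup>2 * misfit F y p) / (1 - 4 * c\<^sup>2)"
proof -
  define a where "a = norm (blinfun_apply (F' p) (q - p) + F p - y)"
  define u where "u = norm (F p - y)"
  define v where "v = norm (F q - y)"
  have "F q - y = (blinfun_apply (F' p) (q - p) + F p - y) - (F p - F q - blinfun_apply (F' p) (p - q))"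
    by (simp add: blinfun.diff_right)
  then have "v \<le> a + norm (F p - F q - blinfun_apply (F' p) (p - q))"
    unfolding a_def v_def by (metis norm_triangle_ineq4)
  also have "\<dots> \<le> a + c * norm (F p - F q)" using tcc by simp
  also have "norm (F p - F q) \<le> u + v"
    using norm_triangle_ineq4[of "F p - y" "F q - y"] by (simp add: u_def v_def)
  then have "a + c * norm (F p - F q) \<le> a + c * (u + v)"
    using c(1) by (simp add: mult_left_mono)
  finally have "v\<^sup>2 \<le> (a + c * (u + v))\<^sup>2" by (intro power_mono) (auto simp: v_def)
  also have "\<dots> \<le> 2 * a\<^sup>2 + 2 * c\<^sup>2 * (u + v)\<^sup>2"
    using power2_add_le[of a "c * (u + v)"] by (simp add: power_mult_distrib)
  also have "\<dots> \<le> 2 * a\<^sup>2 + 2 * c\<^sup>2 * (2 * u\<^sup>2 + 2 * v\<^sup>2)"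
    by (intro add_left_mono mult_left_mono power2_add_le) simp
  finally have "(1 - 4 * c\<^sup>2) * v\<^sup>2 \<le> 2 * a\<^sup>2 + 4 * c\<^sup>2 * u\<^sup>2"
    by (simp add: algebra_simps)
  then show ?thesis
    using c(2) unfolding misfit_def lin_misfit_def a_def[symmetric] u_def[symmetric] v_def[symmetric]
    by (simp add: pos_le_divide_eq mult.commute)
qed

theorem theorem1:
  fixes A :: "'q::{real_inner,complete_space} \<Rightarrow> 'v::{real_inner,complete_space} \<Rightarrow>
                ('w::{real_inner,complete_space} \<Rightarrow>\<^sub>L real)"
    and f :: "'w \<Rightarrow>\<^sub>L real"
    and C :: "'v \<Rightarrow> 'g::{real_inner,complete_space}"
    and S :: "'q \<Rightarrow> 'v"
    and D :: "'q set"
    and F :: "'q \<Rightarrow> 'g"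
    and F' :: "'q \<Rightarrow> ('q \<Rightarrow>\<^sub>L 'g)"
    and g :: 'g
    and q0 qstart :: 'q
    and \<rho> ctc \<tau> \<theta>l \<theta>u c1 c2 c3 :: real
    \<comment> \<open>Data for each noise level \<open>\<delta>\<close> in the set \<open>\<Delta>\<close> of noise levels considered:\<close>
    and \<Delta> :: "real set"
    and gd :: "real \<Rightarrow> 'g"
    \<comment> \<open>Data for each noise level \<open>\<delta>\<close> and step \<open>k\<close>:\<close>
    and \<beta> :: "real \<Rightarrow> nat \<Rightarrow> real"
    and Qh :: "real \<Rightarrow> nat \<Rightarrow> 'q set"
    and Vh :: "real \<Rightarrow> nat \<Rightarrow> 'v set"
    and Wh :: "real \<Rightarrow> nat \<Rightarrow> 'w set"
    and Sh :: "real \<Rightarrow> nat \<Rightarrow> 'q \<Rightarrow> 'v"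
    and Fh :: "real \<Rightarrow> nat \<Rightarrow> 'q \<Rightarrow> 'g"
    and Fh' :: "real \<Rightarrow> nat \<Rightarrow> 'q \<Rightarrow> ('q \<Rightarrow>\<^sub>L 'g)"
    and qold qh qc :: "real \<Rightarrow> nat \<Rightarrow> 'q"
    and I1 I2 I3 I4 I1h I2h I3h I4h \<eta>1 \<eta>2 \<eta>3 \<eta>4 r :: "real \<Rightarrow> nat \<Rightarrow> real"
    and kstar :: "real \<Rightarrow> enat"
  \<comment> \<open>Forward operator\<close>
  assumes S_solution: "solution_operator D A f UNIV UNIV S"
    and S_stable: "continuous_on D S"
    and linearization: "linearization_stably_solvable D A S"
    and F_def: "F = C \<circ> S"
    and F_deriv: "\<And>q. q \<in> D \<Longrightarrow> (F has_derivative blinfun_apply (F' q)) (at q within D)"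
    and weakly_closed: "\<And>qs q. (\<And>n. qs n \<in> D) \<Longrightarrow> weakly_converges qs q \<Longrightarrow>
          (\<lambda>n. F (qs n)) \<longlonglongrightarrow> g \<Longrightarrow> q \<in> D \<and> F q = g"
    and rho: "\<rho> > 0"
    and ball_subset: "cball q0 \<rho> \<subseteq> D"
    and tangential_cone: "\<And>q q'. q \<in> cball q0 \<rho> \<Longrightarrow> q' \<in> cball q0 \<rho> \<Longrightarrow>
          norm (F q - F q' - blinfun_apply (F' q) (q - q')) \<le> ctc * norm (F q - F q')"
    and solution_exists: "\<exists>qd\<in>cball q0 \<rho>. F qd = g"
  \<comment> \<open>Constants\<close>
    and ctc: "0 < ctc" "ctc < 1/4"
    and tau: "\<tau> > 0"
    and theta: "0 < \<theta>l" "\<theta>l < \<theta>u"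
    and theta_lower: "2 * (ctc\<^sup>2 + (1 + ctc)\<^sup>2 / \<tau>\<^sup>2) < \<theta>l"
    and theta_upper: "(2 * \<theta>u + 4 * ctc\<^sup>2) / (1 - 4 * ctc\<^sup>2) < 1"
    and c_pos: "c1 > 0" "c2 > 0" "c3 > 0"
    and c2_c3: "(1 + c3) * ((2 * \<theta>u + 4 * ctc\<^sup>2) / (1 - 4 * ctc\<^sup>2)) \<le> c2" "c2 < 1"
  \<comment> \<open>Noisy data\<close>
    and noise_levels: "\<Delta> \<subseteq> {0<..}"
    and noise: "\<And>\<delta>. \<delta> \<in> \<Delta> \<Longrightarrow> norm (g - gd \<delta>) \<le> \<delta>"
  \<comment> \<open>Quantities of interest and stopping index\<close>
    and I1_def: "I1 = (\<lambda>\<delta> k. tikhonov F F' (gd \<delta>) (\<beta> \<delta> k) q0 (qold \<delta> k) (qc \<delta> k))"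
    and I2_def: "I2 = (\<lambda>\<delta> k. lin_misfit F F' (gd \<delta>) (qold \<delta> k) (qc \<delta> k))"
    and I3_def: "I3 = (\<lambda>\<delta> k. misfit F (gd \<delta>) (qold \<delta> k))"
    and I4_def: "I4 = (\<lambda>\<delta> k. misfit F (gd \<delta>) (qc \<delta> k))"
    and I1h_def: "I1h = (\<lambda>\<delta> k. tikhonov (Fh \<delta> k) (Fh' \<delta> k) (gd \<delta>) (\<beta> \<delta> k) q0
                                  (qold \<delta> k) (qh \<delta> k))"
    and I2h_def: "I2h = (\<lambda>\<delta> k. lin_misfit (Fh \<delta> k) (Fh' \<delta> k) (gd \<delta>) (qold \<delta> k) (qh \<delta> k))"
    and I3h_def: "I3h = (\<lambda>\<delta> k. misfit (Fh \<delta> k) (gd \<delta>) (qold \<delta> k))"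
    and I4h_def: "I4h = (\<lambda>\<delta> k. misfit (Fh \<delta> k) (gd \<delta>) (qh \<delta> k))"
    and kstar_def: "kstar = (\<lambda>\<delta>. stopping_index (I3h \<delta>) (\<tau>\<^sup>2 * \<delta>\<^sup>2))"
  \<comment> \<open>Discretization; evaluating \<open>I3h\<close> at the stopping index requires \<open>k = k\<^sub>*\<close> here\<close>
    and spaces: "\<And>\<delta> k. \<delta> \<in> \<Delta> \<Longrightarrow> enat k \<le> kstar \<delta> \<Longrightarrow>
          fin_dim_subspace (Qh \<delta> k) \<and> fin_dim_subspace (Vh \<delta> k) \<and> fin_dim_subspace (Wh \<delta> k)"
    and Sh_solution: "\<And>\<delta> k. \<delta> \<in> \<Delta> \<Longrightarrow> enat k \<le> kstar \<delta> \<Longrightarrow>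
          solution_operator D A f (Vh \<delta> k) (Wh \<delta> k) (Sh \<delta> k)"
    and Fh_def: "Fh = (\<lambda>\<delta> k. C \<circ> Sh \<delta> k)"
    and Fh_deriv: "\<And>\<delta> k q. \<delta> \<in> \<Delta> \<Longrightarrow> enat k \<le> kstar \<delta> \<Longrightarrow> q \<in> D \<Longrightarrow>
          (Fh \<delta> k has_derivative blinfun_apply (Fh' \<delta> k q)) (at q within D)"
  \<comment> \<open>Iteration, up to the stopping index\<close>
    and start: "qstart \<in> cball q0 \<rho>" "\<And>\<delta>. \<delta> \<in> \<Delta> \<Longrightarrow> qold \<delta> 0 = qstart"
    and qold_in: "\<And>\<delta> k. \<delta> \<in> \<Delta> \<Longrightarrow> enat k \<le> kstar \<delta> \<Longrightarrow> qold \<delta> k \<in> Qh \<delta> k"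
    and beta_pos: "\<And>\<delta> k. \<delta> \<in> \<Delta> \<Longrightarrow> enat k < kstar \<delta> \<Longrightarrow> \<beta> \<delta> k > 0"
    and qh_min: "\<And>\<delta> k. \<delta> \<in> \<Delta> \<Longrightarrow> enat k < kstar \<delta> \<Longrightarrow>
          is_arg_min (tikhonov (Fh \<delta> k) (Fh' \<delta> k) (gd \<delta>) (\<beta> \<delta> k) q0 (qold \<delta> k))
            (\<lambda>q. q \<in> Qh \<delta> k) (qh \<delta> k)"
    and qc_min: "\<And>\<delta> k. \<delta> \<in> \<Delta> \<Longrightarrow> enat k < kstar \<delta> \<Longrightarrow>
          is_arg_min (tikhonov F F' (gd \<delta>) (\<beta> \<delta> k) q0 (qold \<delta> k)) (\<lambda>q. q \<in> UNIV) (qc \<delta> k)"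
    and qold_Suc: "\<And>\<delta> k. \<delta> \<in> \<Delta> \<Longrightarrow> enat k < kstar \<delta> \<Longrightarrow> qold \<delta> (Suc k) = qh \<delta> k"
    and beta_choice: "\<And>\<delta> k. \<delta> \<in> \<Delta> \<Longrightarrow> enat k < kstar \<delta> \<Longrightarrow>
          \<theta>l * I3h \<delta> k \<le> I2h \<delta> k \<and> I2h \<delta> k \<le> \<theta>u * I3h \<delta> k"
  \<comment> \<open>Discretization errors\<close>
    and err1: "\<And>\<delta> k. \<delta> \<in> \<Delta> \<Longrightarrow> enat k < kstar \<delta> \<Longrightarrow> \<bar>I1h \<delta> k - I1 \<delta> k\<bar> \<le> \<eta>1 \<delta> k"
    and err2: "\<And>\<delta> k. \<delta> \<in> \<Delta> \<Longrightarrow> enat k < kstar \<delta> \<Longrightarrow> \<bar>I2h \<delta> k - I2 \<delta> k\<bar> \<le> \<eta>2 \<delta> k"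
    and err3: "\<And>\<delta> k. \<delta> \<in> \<Delta> \<Longrightarrow> enat k \<le> kstar \<delta> \<Longrightarrow> \<bar>I3h \<delta> k - I3 \<delta> k\<bar> \<le> \<eta>3 \<delta> k"
    and err4: "\<And>\<delta> k. \<delta> \<in> \<Delta> \<Longrightarrow> enat k < kstar \<delta> \<Longrightarrow> \<bar>I4h \<delta> k - I4 \<delta> k\<bar> \<le> \<eta>4 \<delta> k"
    and eta1_eta3: "\<And>\<delta> k. \<delta> \<in> \<Delta> \<Longrightarrow> enat k < kstar \<delta> \<Longrightarrow>
          \<eta>1 \<delta> k + 2 * ctc\<^sup>2 * \<eta>3 \<delta> k
            \<le> (\<theta>l - 2 * (ctc\<^sup>2 + (1 + ctc)\<^sup>2 / \<tau>\<^sup>2)) * I3h \<delta> k"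
    and eta3: "\<And>\<delta> k. \<delta> \<in> \<Delta> \<Longrightarrow> enat k \<le> kstar \<delta> \<Longrightarrow> \<eta>3 \<delta> k \<le> c1 * I3h \<delta> k"
    and eta_lim: "\<And>\<delta>. \<delta> \<in> \<Delta> \<Longrightarrow> \<eta>2 \<delta> \<longlonglongrightarrow> 0" "\<And>\<delta>. \<delta> \<in> \<Delta> \<Longrightarrow> \<eta>3 \<delta> \<longlonglongrightarrow> 0"
          "\<And>\<delta>. \<delta> \<in> \<Delta> \<Longrightarrow> \<eta>4 \<delta> \<longlonglongrightarrow> 0"
    and step_change: "\<And>\<delta> k. \<delta> \<in> \<Delta> \<Longrightarrow> k > 0 \<Longrightarrow> enat k \<le> kstar \<delta> \<Longrightarrow>
          I3h \<delta> k \<le> (1 + c3) * I4h \<delta> (k - 1) + r \<delta> k"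
    and r_lim: "\<And>\<delta>. \<delta> \<in> \<Delta> \<Longrightarrow> r \<delta> \<longlonglongrightarrow> 0"
  shows
    \<comment> \<open>(i)\<close>
    "(\<forall>\<delta>\<in>\<Delta>. \<forall>qd\<in>cball q0 \<rho>. F qd = g \<longrightarrow>
        (\<forall>k. enat k < kstar \<delta> \<longrightarrow> (norm (qh \<delta> k - q0))\<^sup>2 \<le> (norm (qd - q0))\<^sup>2)) \<and>
    \<comment> \<open>(ii)\<close>
     (\<forall>\<delta>\<in>\<Delta>. kstar \<delta> \<noteq> \<infinity>) \<and>
    \<comment> \<open>(iii)\<close>
     (\<forall>\<delta>s. (\<forall>n. \<delta>s n \<in> \<Delta>) \<longrightarrow> \<delta>s \<longlonglongrightarrow> 0 \<longrightarrow>
        (\<exists>s q. strict_mono s \<and>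
           weakly_converges (\<lambda>n. qold (\<delta>s (s n)) (the_enat (kstar (\<delta>s (s n))))) q) \<and>
        (\<forall>s q. strict_mono s \<longrightarrow>
           weakly_converges (\<lambda>n. qold (\<delta>s (s n)) (the_enat (kstar (\<delta>s (s n))))) q \<longrightarrow>
           q \<in> D \<and> F q = g \<and>
           (\<lambda>n. qold (\<delta>s (s n)) (the_enat (kstar (\<delta>s (s n))))) \<longlonglongrightarrow> q)) \<and>
     (\<forall>qd. {q \<in> D. F q = g} = {qd} \<longrightarrow>
        ((\<lambda>\<delta>. qold \<delta> (the_enat (kstar \<delta>))) \<longlongrightarrow> qd) (at 0 within \<Delta>))"
proof -
  \<comment> \<open>\<open>b\<close> is the contraction factor of \<open>theta_upper\<close>, and
    \<open>theta_lower\<close> reads \<open>2 * \<kappa> < \<theta>l\<close>. The value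
    \<open>the_enat (kstar \<delta>)\<close> becomes meaningful once \<open>part2\<close> shows
    finiteness.\<close>
  define b where "b = (2 * \<theta>u + 4 * ctc\<^sup>2) / (1 - 4 * ctc\<^sup>2)"
  define \<kappa> where "\<kappa> = ctc\<^sup>2 + (1 + ctc)\<^sup>2 / \<tau>\<^sup>2"
  define x where "x \<delta> = qold \<delta> (the_enat (kstar \<delta>))" for \<delta>
  have ctc4: "4 * ctc\<^sup>2 < 1"
    using ctc power_strict_mono[of ctc "1/4" 2] by (simp add: power2_eq_square)
  have ctc0: "0 \<le> ctc" using ctc by simp
  have data: "norm (F qd - gd \<delta>) \<le> \<delta>" if "\<delta> \<in> \<Delta>" "F qd = g" for qd \<delta>
    using noise[OF that(1)] that(2) by simp
  have before: "\<tau>\<^sup>2 * \<delta>\<^sup>2 < I3h \<delta> k" if "enat k < kstar \<delta>" for \<delta> k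
    using less_stopping_index[of k "I3h \<delta>"] that by (simp add: kstar_def)

  \<comment> \<open>Bound on the discrete iterates\<close>
  \<comment> \<open>A solution \<open>qd\<close> need not lie in \<open>Qh \<delta> k\<close>, so it
    is compared with the continuous minimizer. Before stopping, \<open>\<delta>\<^sup>2\<close> is
    below \<open>I3h \<delta> k / \<tau>\<^sup>2\<close>, which moves the noise into
    \<open>\<kappa>\<close>; \<open>err3\<close> exchanges \<open>I3\<close> for
    \<open>I3h\<close>.\<close>
  have I1_le: "I1 \<delta> k \<le> 2 * \<kappa> * I3h \<delta> k + 2 * ctc\<^sup>2 * \<eta>3 \<delta> k + 1 / \<beta> \<delta> k * (norm (qd - q0))\<^sup>2"
    if \<delta>: "\<delta> \<in> \<Delta>" and k: "enat k < kstar \<delta>" and qd: "qd \<in> cball q0 \<rho>" "F qd = g"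
      and p: "qold \<delta> k \<in> cball q0 \<rho>" for \<delta> k qd
  proof -
    have "I3 \<delta> k \<le> I3h \<delta> k + \<eta>3 \<delta> k" using err3[OF \<delta> less_imp_le[OF k]] by linarith
    then have 1: "2 * ctc\<^sup>2 * I3 \<delta> k \<le> 2 * ctc\<^sup>2 * (I3h \<delta> k + \<eta>3 \<delta> k)"
      by (intro mult_left_mono) auto
    have "\<delta>\<^sup>2 \<le> I3h \<delta> k / \<tau>\<^sup>2"
      using before[OF k] tau by (simp add: field_simps)
    then have 2: "2 * (1 + ctc)\<^sup>2 * \<delta>\<^sup>2 \<le> 2 * (1 + ctc)\<^sup>2 * (I3h \<delta> k / \<tau>\<^sup>2)"
      by (intro mult_left_mono) auto
    have 3: "2 * ctc\<^sup>2 * I3 \<delta> k + 2 * (1 + ctc)\<^sup>2 * \<delta>\<^sup>2 \<le>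
        2 * \<kappa> * I3h \<delta> k + 2 * ctc\<^sup>2 * \<eta>3 \<delta> k"
      using 1 2 by (simp add: \<kappa>_def algebra_simps)
    have "I1 \<delta> k \<le> tikhonov F F' (gd \<delta>) (\<beta> \<delta> k) q0 (qold \<delta> k) qd"
      using qc_min[OF \<delta> k] unfolding I1_def by (simp add: is_arg_min_linorder)
    also have "\<dots> \<le> 2 * ctc\<^sup>2 * I3 \<delta> k + 2 * (1 + ctc)\<^sup>2 * \<delta>\<^sup>2 + 1 / \<beta> \<delta> k * (norm (qd - q0))\<^sup>2"
      using lin_misfit_at_solution_le[of F _ _ F', OF tangential_cone[OF p qd(1)] data[OF \<delta> qd(2)] ctc0]
      by (simp add: tikhonov_def I3_def)
    finally show ?thesis using 3 by linarith
  qed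

  \<comment> \<open>By \<open>err1\<close> and \<open>eta1_eta3\<close>, all terms of
    \<open>I1_le\<close> other than the penalty sum up to at most
    \<open>\<theta>l * I3h \<delta> k\<close>. As \<open>I2h\<close> is at least this large, only
    the comparison of the penalties remains.\<close>
  have qh_bound: "(norm (qh \<delta> k - q0))\<^sup>2 \<le> (norm (qd - q0))\<^sup>2"
    if \<delta>: "\<delta> \<in> \<Delta>" and k: "enat k < kstar \<delta>" and qd: "qd \<in> cball q0 \<rho>" "F qd = g"
      and p: "qold \<delta> k \<in> cball q0 \<rho>" for \<delta> k qd
  proof -
    have "I1h \<delta> k = I2h \<delta> k + 1 / \<beta> \<delta> k * (norm (qh \<delta> k - q0))\<^sup>2"
      by (simp add: I1h_def I2h_def tikhonov_def)
    then have "1 / \<beta> \<delta> k * (norm (qh \<delta> k - q0))\<^sup>2 \<le> 1 / \<beta> \<delta> k * (norm (qd - q0))\<^sup>2"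
      using I1_le[OF \<delta> k qd p] err1[OF \<delta> k] beta_choice[OF \<delta> k] eta1_eta3[OF \<delta> k]
      unfolding \<kappa>_def[symmetric] left_diff_distrib by linarith
    then show ?thesis using beta_pos[OF \<delta> k] by (simp add: divide_le_cancel)
  qed

  have in_ball: "q \<in> cball q0 \<rho>" if "(norm (q - q0))\<^sup>2 \<le> (norm (qd - q0))\<^sup>2" "qd \<in> cball q0 \<rho>" for q qd
    using that by (auto simp: dist_norm norm_minus_commute abs_le_square_iff[symmetric])

  obtain qd0 where qd0: "qd0 \<in> cball q0 \<rho>" "F qd0 = g" using solution_exists by blast

  \<comment> \<open>The induction alternates with \<open>qh_bound\<close>: an iterate in the ball
    admits the cone condition, which keeps the next one there. The index \<open>kstar\<close> is
    included for the returned iterate.\<close>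
  have qold_ball: "qold \<delta> k \<in> cball q0 \<rho>" if \<delta>: "\<delta> \<in> \<Delta>" and "enat k \<le> kstar \<delta>" for \<delta> k
    using that(2)
  proof (induction k)
    case 0
    then show ?case using start \<delta> by simp
  next
    case (Suc k)
    then have k: "enat k < kstar \<delta>" by (simp add: Suc_ile_eq)
    then have "qold \<delta> k \<in> cball q0 \<rho>" using Suc.IH by simp
    then show ?case
      using in_ball[OF qh_bound[OF \<delta> k qd0] qd0(1)] qold_Suc[OF \<delta> k] by simp
  qed

  have part1: "(norm (qh \<delta> k - q0))\<^sup>2 \<le> (norm (qd - q0))\<^sup>2"
    if "\<delta> \<in> \<Delta>" "qd \<in> cball q0 \<rho>" "F qd = g" "enat k < kstar \<delta>" for \<delta> k qd
    using qh_bound that qold_ball by simp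

  \<comment> \<open>Finite termination\<close>
  have part2: "kstar \<delta> \<noteq> \<infinity>" if \<delta>: "\<delta> \<in> \<Delta>" for \<delta>
  proof
    assume inf: "kstar \<delta> = \<infinity>"
    then have k: "enat k < kstar \<delta>" and k': "enat k \<le> kstar \<delta>" for k by simp_all
    define m where "m = \<tau>\<^sup>2 * \<delta>\<^sup>2"
    have m: "m > 0" using tau noise_levels \<delta> by (auto simp: m_def)
    have m_le: "m \<le> I3h \<delta> k" for k using before[OF k] by (simp add: m_def less_imp_le)
    \<comment> \<open>The cone condition is needed at \<open>qc\<close> as well. There
      \<open>\<eta>2\<close> enters, which is only known to tend to 0; but without stopping,
      \<open>I3h\<close> stays above \<open>m > 0\<close>, so the slack in the penalty comparison is
      at least \<open>d\<close> and eventually outweighs the errors.\<close>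
    define d where "d = (\<theta>l - 2 * \<kappa>) * m"
    have gap: "\<theta>l - 2 * \<kappa> > 0" using theta_lower by (simp add: \<kappa>_def)
    have d: "d > 0" using gap m by (simp add: d_def)
    have "(\<lambda>k. \<eta>2 \<delta> k + 2 * ctc\<^sup>2 * \<eta>3 \<delta> k) \<longlonglongrightarrow> 0 + 2 * ctc\<^sup>2 * 0"
      by (intro tendsto_intros eta_lim \<delta>)
    then have small: "eventually (\<lambda>k. \<eta>2 \<delta> k + 2 * ctc\<^sup>2 * \<eta>3 \<delta> k < d) sequentially"
      using d by (simp add: order_tendstoD(2))
    have qc_ball: "qc \<delta> k \<in> cball q0 \<rho>" if "\<eta>2 \<delta> k + 2 * ctc\<^sup>2 * \<eta>3 \<delta> k < d" for k
    proof -
      have "d \<le> (\<theta>l - 2 * \<kappa>) * I3h \<delta> k" unfolding d_def using gap m_le by (intro mult_left_mono) auto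
      moreover have "I1 \<delta> k = I2 \<delta> k + 1 / \<beta> \<delta> k * (norm (qc \<delta> k - q0))\<^sup>2"
        by (simp add: I1_def I2_def tikhonov_def)
      ultimately have "1 / \<beta> \<delta> k * (norm (qc \<delta> k - q0))\<^sup>2 \<le> 1 / \<beta> \<delta> k * (norm (qd0 - q0))\<^sup>2"
        using I1_le[OF \<delta> k qd0 qold_ball[OF \<delta> k'], of k] err2[OF \<delta> k, of k]
          beta_choice[OF \<delta> k, of k] that
        unfolding left_diff_distrib by linarith
      then have "(norm (qc \<delta> k - q0))\<^sup>2 \<le> (norm (qd0 - q0))\<^sup>2"
        using beta_pos[OF \<delta> k] by (simp add: divide_le_cancel)
      then show ?thesis using in_ball qd0(1) by blast
    qed
    \<comment> \<open>All error terms of one step; \<open>r\<close> has index \<open>Suc k\<close>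
      because \<open>step_change\<close> is applied at the new step.\<close>
    define e where "e k = (1 + c3) * ((2 * \<eta>2 \<delta> k + 4 * ctc\<^sup>2 * \<eta>3 \<delta> k) / (1 - 4 * ctc\<^sup>2) + \<eta>4 \<delta> k)
        + r \<delta> (Suc k)" for k
    have "e \<longlonglongrightarrow> (1 + c3) * ((2 * 0 + 4 * ctc\<^sup>2 * 0) / (1 - 4 * ctc\<^sup>2) + 0) + 0"
      unfolding e_def using ctc4 by (intro tendsto_intros eta_lim \<delta> LIMSEQ_Suc r_lim) auto
    then have e: "e \<longlonglongrightarrow> 0" by simp
    \<comment> \<open>The chain runs from \<open>I3h\<close> at \<open>Suc k\<close> to
      \<open>I4h\<close> by \<open>step_change\<close>, to \<open>I4\<close> by \<open>err4\<close>,
      to \<open>I2\<close> and \<open>I3\<close> by the cone condition, and back to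
      \<open>I3h\<close> by \<open>err2\<close>, \<open>err3\<close> and the upper bound with
      \<open>\<theta>u\<close>.\<close>
    have contraction: "I3h \<delta> (Suc k) \<le> c2 * I3h \<delta> k + e k"
      if "\<eta>2 \<delta> k + 2 * ctc\<^sup>2 * \<eta>3 \<delta> k < d" for k
    proof -
      have "I4 \<delta> k \<le> (2 * I2 \<delta> k + 4 * ctc\<^sup>2 * I3 \<delta> k) / (1 - 4 * ctc\<^sup>2)"
        using misfit_le_lin_misfit[of F _ _ F', OF tangential_cone[OF qold_ball[OF \<delta> k'] qc_ball[OF that]] ctc0 ctc4]
        by (simp add: I4_def I2_def I3_def)
      also have "\<dots> \<le> (2 * (\<theta>u * I3h \<delta> k + \<eta>2 \<delta> k) + 4 * ctc\<^sup>2 * (I3h \<delta> k + \<eta>3 \<delta> k)) / (1 - 4 * ctc\<^sup>2)"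
      proof (intro divide_right_mono add_mono mult_left_mono)
        show "I2 \<delta> k \<le> \<theta>u * I3h \<delta> k + \<eta>2 \<delta> k"
          using err2[OF \<delta> k, of k] beta_choice[OF \<delta> k, of k] by linarith
        show "I3 \<delta> k \<le> I3h \<delta> k + \<eta>3 \<delta> k" using err3[OF \<delta> k', of k] by linarith
      qed (use ctc4 in auto)
      also have "\<dots> = b * I3h \<delta> k + (2 * \<eta>2 \<delta> k + 4 * ctc\<^sup>2 * \<eta>3 \<delta> k) / (1 - 4 * ctc\<^sup>2)"
        by (simp add: b_def add_divide_distrib[symmetric] algebra_simps)
      finally have "I4h \<delta> k \<le> b * I3h \<delta> k +
          ((2 * \<eta>2 \<delta> k + 4 * ctc\<^sup>2 * \<eta>3 \<delta> k) / (1 - 4 * ctc\<^sup>2) + \<eta>4 \<delta> k)"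
        using err4[OF \<delta> k, of k] by linarith
      then have "(1 + c3) * I4h \<delta> k \<le> (1 + c3) * (b * I3h \<delta> k +
          ((2 * \<eta>2 \<delta> k + 4 * ctc\<^sup>2 * \<eta>3 \<delta> k) / (1 - 4 * ctc\<^sup>2) + \<eta>4 \<delta> k))"
        using c_pos by (intro mult_left_mono) auto
      moreover have "(1 + c3) * b * I3h \<delta> k \<le> c2 * I3h \<delta> k"
        using c2_c3(1) m m_le[of k] unfolding b_def[symmetric] by (intro mult_right_mono) auto
      ultimately show ?thesis
        using step_change[OF \<delta> _ k', of "Suc k"] unfolding e_def by (simp add: algebra_simps)
    qed
    show False
      by (rule no_positive_contraction[OF c2_c3(2) e m m_le eventually_mono[OF small contraction]])
  qed

  \<comment> \<open>Convergence as the noise level tends to 0\<close>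
  have kstar_enat: "kstar \<delta> = enat (the_enat (kstar \<delta>))" if "\<delta> \<in> \<Delta>" for \<delta>
    using part2[OF that] by auto
  have x_ball: "x \<delta> \<in> cball q0 \<rho>" if "\<delta> \<in> \<Delta>" for \<delta>
    unfolding x_def using qold_ball[OF that, of "the_enat (kstar \<delta>)"] kstar_enat[OF that] by simp
  \<comment> \<open>Part (i) concerns iterates produced by a step. If
    \<open>kstar \<delta> = 0\<close>, the start is returned, of which only membership in the ball
    is known.\<close>
  have x_cases: "x \<delta> = qstart \<and> kstar \<delta> = 0 \<or>
      (\<forall>qd\<in>cball q0 \<rho>. F qd = g \<longrightarrow> norm (x \<delta> - q0) \<le> norm (qd - q0))" if \<delta>: "\<delta> \<in> \<Delta>" for \<delta>
  proof (cases "the_enat (kstar \<delta>)")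
    case 0
    then show ?thesis
      using kstar_enat[OF \<delta>] start(2)[OF \<delta>] by (simp add: x_def zero_enat_def)
  next
    case (Suc k)
    then have k: "enat k < kstar \<delta>" using kstar_enat[OF \<delta>] by (metis enat_ord_simps(2) lessI)
    then show ?thesis
      using part1[OF \<delta> _ _ k] qold_Suc[OF \<delta> k] Suc by (simp add: x_def abs_le_square_iff[symmetric])
  qed
  \<comment> \<open>The stopping rule bounds the discrete misfit; the relative bound
    \<open>eta3\<close>, taken at \<open>k = kstar\<close> itself, passes it to the exact
    misfit.\<close>
  have residual: "(norm (F (x \<delta>) - gd \<delta>))\<^sup>2 \<le> (1 + c1) * (\<tau>\<^sup>2 * \<delta>\<^sup>2)" if \<delta>: "\<delta> \<in> \<Delta>" for \<delta>
  proof -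
    define k where "k = the_enat (kstar \<delta>)"
    have k: "kstar \<delta> = enat k" using kstar_enat[OF \<delta>] by (simp add: k_def)
    then have "I3h \<delta> k \<le> \<tau>\<^sup>2 * \<delta>\<^sup>2" by (intro stopping_indexE) (simp add: kstar_def)
    then have "(1 + c1) * I3h \<delta> k \<le> (1 + c1) * (\<tau>\<^sup>2 * \<delta>\<^sup>2)"
      using c_pos by (intro mult_left_mono) auto
    moreover have "I3 \<delta> k \<le> (1 + c1) * I3h \<delta> k"
      using err3[OF \<delta>, of k] eta3[OF \<delta>, of k] k by (simp add: algebra_simps)
    ultimately show ?thesis by (simp add: I3_def misfit_def x_def k_def)
  qed

  have F_lim: "(\<lambda>n. F (x (\<delta>s n))) \<longlonglongrightarrow> g"
    if \<delta>s: "\<forall>n. \<delta>s n \<in> \<Delta>" and lim: "\<delta>s \<longlonglongrightarrow> 0" for \<delta>s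
  proof -
    have bound: "norm (F (x (\<delta>s n)) - g) \<le> sqrt ((1 + c1) * (\<tau>\<^sup>2 * (\<delta>s n)\<^sup>2)) + \<delta>s n" for n
    proof -
      have "norm (F (x (\<delta>s n)) - g) \<le> norm (F (x (\<delta>s n)) - gd (\<delta>s n)) + norm (g - gd (\<delta>s n))"
        using norm_triangle_ineq4[of "F (x (\<delta>s n)) - gd (\<delta>s n)" "g - gd (\<delta>s n)"] by simp
      also have "\<dots> \<le> sqrt ((1 + c1) * (\<tau>\<^sup>2 * (\<delta>s n)\<^sup>2)) + \<delta>s n"
        using \<delta>s by (intro add_mono real_le_rsqrt residual noise) auto
      finally show ?thesis .
    qed
    have "(\<lambda>n. sqrt ((1 + c1) * (\<tau>\<^sup>2 * (\<delta>s n)\<^sup>2)) + \<delta>s n) \<longlonglongrightarrow>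
        sqrt ((1 + c1) * (\<tau>\<^sup>2 * 0\<^sup>2)) + 0"
      by (intro tendsto_intros lim)
    then have "(\<lambda>n. sqrt ((1 + c1) * (\<tau>\<^sup>2 * (\<delta>s n)\<^sup>2)) + \<delta>s n) \<longlonglongrightarrow> 0"
      by simp
    then have "(\<lambda>n. F (x (\<delta>s n)) - g) \<longlonglongrightarrow> 0"
      by (rule Lim_null_comparison[OF always_eventually[OF allI[OF bound]]])
    then show ?thesis by (rule LIM_zero_cancel)
  qed

  have strong: "q \<in> D \<and> F q = g \<and> (\<lambda>n. x (\<delta>s n)) \<longlonglongrightarrow> q"
    if \<delta>s: "\<forall>n. \<delta>s n \<in> \<Delta>" and lim: "\<delta>s \<longlonglongrightarrow> 0"
      and w: "weakly_converges (\<lambda>n. x (\<delta>s n)) q" for \<delta>s q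
  proof -
    have q: "q \<in> D \<and> F q = g"
      using weakly_closed[OF _ w F_lim[OF \<delta>s lim]] x_ball \<delta>s ball_subset by blast
    \<comment> \<open>Once in the ball, the weak limit \<open>q\<close> can itself play the role of
      \<open>qd\<close> in \<open>x_cases\<close>, which gives the norm bound needed for strong
      convergence.\<close>
    have "norm (q - q0) \<le> \<rho>"
      by (rule weakly_converges_norm_le[OF w])
        (use x_ball \<delta>s in \<open>auto simp: dist_norm norm_minus_commute\<close>)
    then have q_ball: "q \<in> cball q0 \<rho>" by (simp add: dist_norm norm_minus_commute)
    \<comment> \<open>If the iteration stops immediately infinitely often, its constant value \<open>qstart\<close> is the weak limit,
      so the missing bound of (i) is not needed there.\<close>
    have start_or_less: "\<exists>N. \<forall>n\<ge>N. norm (x (\<delta>s n) - q0) \<le> norm (q - q0) \<or> x (\<delta>s n) = q"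
    proof (cases "finite {n. kstar (\<delta>s n) = 0}")
      case True
      then obtain N where "\<forall>n\<in>{n. kstar (\<delta>s n) = 0}. n < N"
        using finite_nat_set_iff_bounded by blast
      then have "kstar (\<delta>s n) \<noteq> 0" if "n \<ge> N" for n using that leD by blast
      then have "norm (x (\<delta>s n) - q0) \<le> norm (q - q0)" if "n \<ge> N" for n
        using x_cases[of "\<delta>s n"] \<delta>s q q_ball that by simp
      then show ?thesis by blast
    next
      case False
      then obtain s where s: "strict_mono (s :: nat \<Rightarrow> nat)" "\<forall>n. kstar (\<delta>s (s n)) = 0"
        using infinite_enumerate by blast
      have "x (\<delta>s (s n)) = qstart" for n
        using start(2) \<delta>s s(2) by (simp add: x_def zero_enat_def)
      then have const: "(\<lambda>n. inner qstart y) \<longlonglongrightarrow> inner q y" for y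
        using LIMSEQ_subseq_LIMSEQ[OF _ s(1), of "\<lambda>n. inner (x (\<delta>s n)) y" "inner q y"] w
        by (simp add: weakly_converges_def comp_def)
      have "inner qstart y = inner q y" for y
        by (rule LIMSEQ_unique[OF tendsto_const const])
      then have "inner (qstart - q) (qstart - q) = 0"
        by (simp only: inner_diff_left diff_self)
      then have "qstart = q" by simp
      then have "norm (x (\<delta>s n) - q0) \<le> norm (q - q0) \<or> x (\<delta>s n) = q" for n
        using x_cases[of "\<delta>s n"] \<delta>s q q_ball by auto
      then show ?thesis by blast
    qed
    then obtain N where "\<forall>n\<ge>N. norm (x (\<delta>s n) - q0) \<le> norm (q - q0) \<or> x (\<delta>s n) = q" by blast
    moreover have "weakly_converges (\<lambda>n. x (\<delta>s (n + N))) q"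
      using w by (auto simp: weakly_converges_def
          intro: LIMSEQ_ignore_initial_segment[where f = "\<lambda>n. inner (x (\<delta>s n)) y" for y])
    ultimately have "(\<lambda>n. x (\<delta>s (n + N))) \<longlonglongrightarrow> q"
      by (intro weakly_converges_imp_tendsto[where a = q0]) auto
    then show ?thesis using q LIMSEQ_offset[of "\<lambda>n. x (\<delta>s n)" N] by simp
  qed

  have compact: "\<exists>s q. strict_mono s \<and> weakly_converges (\<lambda>n. x (\<delta>s (s n))) q"
    if "\<forall>n. \<delta>s n \<in> \<Delta>" for \<delta>s :: "nat \<Rightarrow> real"
  proof -
    have "norm (x (\<delta>s n)) \<le> norm q0 + \<rho>" for n
      using x_ball[of "\<delta>s n"] that norm_triangle_sub[of "x (\<delta>s n)" q0]
      by (simp add: dist_norm norm_minus_commute)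
    then show ?thesis
      using bounded_seq_weakly_convergent_subseq[of "\<lambda>n. x (\<delta>s n)"] by metis
  qed

  have subseq_strong: "q \<in> D \<and> F q = g \<and> (\<lambda>n. x (\<delta>s (s n))) \<longlonglongrightarrow> q"
    if "\<forall>n. \<delta>s n \<in> \<Delta>" "\<delta>s \<longlonglongrightarrow> 0" "strict_mono s" "weakly_converges (\<lambda>n. x (\<delta>s (s n))) q" for \<delta>s s q
    using strong[of "\<lambda>n. \<delta>s (s n)"] LIMSEQ_subseq_LIMSEQ[OF that(2,3)] that
    by (simp add: comp_def)

  \<comment> \<open>Subsequence principle: a subsequence staying \<open>e\<close> away from
    \<open>qd\<close> would have a further subsequence converging strongly to a solution, hence to
    \<open>qd\<close>.\<close>
  have unique: "(x \<longlongrightarrow> qd) (at 0 within \<Delta>)" if qd: "{q \<in> D. F q = g} = {qd}" for qd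
    unfolding tendsto_at_iff_sequentially
  proof (intro allI impI, rule ccontr)
    fix \<delta>s assume \<delta>s: "\<forall>i. \<delta>s i \<in> \<Delta> - {0}" "\<delta>s \<longlonglongrightarrow> 0" and neg: "\<not> (x \<circ> \<delta>s) \<longlonglongrightarrow> qd"
    obtain e where e: "e > 0" "\<And>N. \<exists>n\<ge>N. \<not> dist (x (\<delta>s n)) qd < e"
      using neg unfolding lim_sequentially comp_def by blast
    have "infinite {n. \<not> dist (x (\<delta>s n)) qd < e}"
      using e(2) by (simp add: infinite_nat_iff_unbounded_le)
    then obtain s where s: "strict_mono (s :: nat \<Rightarrow> nat)" "\<forall>n. \<not> dist (x (\<delta>s (s n))) qd < e"
      using infinite_enumerate by blast
    have \<delta>s': "\<forall>n. \<delta>s (s n) \<in> \<Delta>" "(\<lambda>n. \<delta>s (s n)) \<longlonglongrightarrow> 0"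
      using \<delta>s(1) LIMSEQ_subseq_LIMSEQ[OF \<delta>s(2) s(1)] by (auto simp: comp_def)
    obtain t q where t: "strict_mono t" "weakly_converges (\<lambda>n. x (\<delta>s (s (t n)))) q"
      using compact[OF \<delta>s'(1)] by blast
    have q: "q \<in> D \<and> F q = g \<and> (\<lambda>n. x (\<delta>s (s (t n)))) \<longlonglongrightarrow> q"
      using subseq_strong[OF \<delta>s' t] .
    then have "q \<in> {q \<in> D. F q = g}" by simp
    then have "q = qd" unfolding qd by simp
    then have "(\<lambda>n. x (\<delta>s (s (t n)))) \<longlonglongrightarrow> qd" using q by simp
    then obtain n where "dist (x (\<delta>s (s (t n)))) qd < e"
      using e(1) unfolding lim_sequentially by blast
    then show False using s(2) by blast
  qed

  show ?thesis
    unfolding x_def[symmetric]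
    by (intro conjI ballI allI impI;
        (rule part1 part2 compact unique; assumption | simp add: subseq_strong))
qed

end
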